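(* Let $B$ be a Blaschke product whose zero sequence $(a_n)$ is an interpolating sequence for $K_B^\infty$. Let $M$ be a constant such that $\|f\|_\infty\le M\,\sup_n|f(a_n)|$ for every $f\in K_B^\infty$. Suppose that $(z_n)$ is a sequence of distinct points of $\mathbb{D}$ and that $\varepsilon$ is a real number with $\rho(a_n,z_n)<1-\varepsilon<\frac{1}{2M}$ for all $n$. Then $(z_n)$ is interpolating for $K_B^\infty$.
   Context: $\mathbb{D}$ is the open unit disk and $\mathbb{T}$ the unit circle. $H^\infty$ is the space of bounded analytic functions on $\mathbb{D}$, with sup norm $\|\cdot\|_\infty$, identified with their boundary functions on $\mathbb{T}$. For an inner function $\theta$, $K_\theta^\infty := H^\infty\cap \theta\,\overline{zH^\infty}$ (as functions on $\mathbb{T}$), where $\overline{zH^\infty}$ is the set of functions whose complex conjugate lies in $zH^\infty$; elements are evaluated at points of $\mathbb{D}$ via their analytic extension. A sequence $(w_n)$ in $\mathbb{D}$ is interpolating for $K_\theta^\infty$ if for every bounded sequence $(\alpha_n)$ of complex numbers there is $f\in K_\theta^\infty$ with $f(w_n)=\alpha_n$ for all $n$. The pseudohyperbolic distance is $\rho(a,z)=\left|\frac{z-a}{1-\overline{a}z}\right|$ for $a,z\in\mathbb{D}$. For a sequence $(a_j)$ in $\mathbb{D}$ with $\sum_j(1-|a_j|)<\infty$, a Blaschke product with zeros $(a_j)$ is $B(z)=\lambda\prod_j \frac{|a_j|}{-a_j}\frac{z-a_j}{1-\overline{a_j}z}$ with $\lambda\in\mathbb{T}$ (with $|a_j|/a_j$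 read as $1$ if $a_j=0$). A constant $M$ as in the statement always exists when $(a_n)$ is interpolating for $K_B^\infty$. *)

theory Defs
  imports "HOL-Complex_Analysis.Complex_Analysis"
begin

definition Hinf :: "(complex \<Rightarrow> complex) set" where
  "Hinf = {f. f holomorphic_on ball 0 1 \<and> bounded (f ` ball 0 1)}"

definition Hinf_norm :: "(complex \<Rightarrow> complex) \<Rightarrow> real" where
  "Hinf_norm f = (SUP z\<in>ball 0 1. norm (f z))"

text \<open>Radial boundary values. By Fatou's theorem a function in \<open>Hinf\<close> has one at almost every
  point of the unit circle, and this is what identifies it with its boundary function.\<close>

definition has_boundary_value :: "(complex \<Rightarrow> complex) \<Rightarrow> complex \<Rightarrow> complex \<Rightarrow> bool" where
  "has_boundary_value f \<zeta> l \<longleftrightarrow> ((\<lambda>r. f (complex_of_real r * \<zeta>)) \<longlongrightarrow> l) (at_left 1)"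

text \<open>The space \<open>H\<^sup>\<infinity> \<inter> \<theta> cnj (z H\<^sup>\<infinity>)\<close>: the boundary functions satisfy
  \<open>f = \<theta> cnj (\<zeta> h)\<close> almost everywhere on the unit circle for some \<open>h\<close> in \<open>Hinf\<close>.
  Its elements are represented by functions on the unit disk (values outside the disk are
  irrelevant). It is meant for inner \<open>\<theta>\<close>; the existence of the three boundary values almost
  everywhere is then no restriction, by Fatou's theorem.\<close>

definition Kinf :: "(complex \<Rightarrow> complex) \<Rightarrow> (complex \<Rightarrow> complex) set" where
  "Kinf \<theta> = {f \<in> Hinf. \<exists>h\<in>Hinf. AE t in lebesgue_on {0..2 * pi}.
     \<exists>u v w. has_boundary_value f (cis t) u \<and> has_boundary_value \<theta> (cis t) v \<and>
             has_boundary_value h (cis t) w \<and> u = v * cnj (cis t * w)}"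

definition interpolating_for :: "(complex \<Rightarrow> complex) set \<Rightarrow> (nat \<Rightarrow> complex) \<Rightarrow> bool" where
  "interpolating_for K w \<longleftrightarrow> (\<forall>n. w n \<in> ball 0 1) \<and>
     (\<forall>\<alpha>::nat \<Rightarrow> complex. bounded (range \<alpha>) \<longrightarrow> (\<exists>f\<in>K. \<forall>n. f (w n) = \<alpha> n))"

definition pseudohyp_dist :: "complex \<Rightarrow> complex \<Rightarrow> real" where
  "pseudohyp_dist a z = norm ((z - a) / (1 - cnj a * z))"

text \<open>The convention \<open>|a| / a = 1\<close> for \<open>a = 0\<close> makes the factor equal to \<open>- z\<close> there.\<close>

definition blaschke_factor :: "complex \<Rightarrow> complex \<Rightarrow> complex" where
  "blaschke_factor a z =
     - (if a = 0 then 1 else complex_of_real (norm a) / a) * ((z - a) / (1 - cnj a * z))"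

text \<open>Under the summability condition the product converges at every point of the disk, in the
  sense of \<^const>\<open>has_prod\<close>, which admits finitely many vanishing factors.\<close>

definition blaschke_product :: "(nat \<Rightarrow> complex) \<Rightarrow> (complex \<Rightarrow> complex) \<Rightarrow> bool" where
  "blaschke_product a B \<longleftrightarrow> (\<forall>j. a j \<in> ball 0 1) \<and> summable (\<lambda>j. 1 - norm (a j)) \<and>
     (\<exists>l. norm l = 1 \<and> (\<forall>z\<in>ball 0 1. B z = l * (\<Prod>j. blaschke_factor (a j) z)))"

end

theory Submission
  imports Defs
begin

text \<open>Given data \<open>\<alpha>\<close> of size at most \<open>A\<close>, choose \<open>f\<^sub>0\<close> in \<open>K\<^sub>B\<^sup>\<infinity>\<close> with \<open>f\<^sub>0(a\<^sub>n) = \<alpha>\<^sub>n\<close>. By the Schwarz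
  lemma it misses \<open>\<alpha>\<^sub>n\<close> at \<open>z\<^sub>n\<close> by at most \<open>2 M A \<rho>(a\<^sub>n, z\<^sub>n) \<le> q A\<close>, where \<open>q = 2 M (1 - \<epsilon>) < 1\<close>. Applying
  this again to the error and summing the resulting geometric series gives the interpolating
  function. The sum stays in \<open>K\<^sub>B\<^sup>\<infinity>\<close> because \<open>|B| = 1\<close> almost everywhere on the circle, so that the
  functions \<open>h\<^sub>k\<close> with \<open>f\<^sub>k = B cnj (\<zeta> h\<^sub>k)\<close> satisfy the same geometric bounds as the \<open>f\<^sub>k\<close>.\<close>

section \<open>Cauchy estimate by means over the unit circle\<close>

text \<open>Cauchy's integral formula on the unit circle, with the kernel bounded through
  \<open>norm (cis t - z) \<ge> 1 - norm z\<close>. At \<open>z = 0\<close> nothing is lost: this is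
  the mean value inequality, the case used for Blaschke products.\<close>

lemma norm_le_circle_mean:
  assumes "G holomorphic_on cball 0 1" "norm z < 1"
  shows "norm (G z) \<le> (\<integral>t. norm (G (cis t)) \<partial>lebesgue_on {0..2*pi}) / (2 * pi * (1 - norm z))"
proof -
  define h where "h t = G (cis t) / (cis t - z) * \<i> * cis t" for t
  have contG: "continuous_on (cball 0 1) G"
    using assms(1) by (rule holomorphic_on_imp_continuous_on)
  have contGc: "continuous_on S (\<lambda>t. G (cis t))" for S
    by (rule continuous_on_compose2[OF contG]) (auto intro!: continuous_intros)
  have nz: "cis t - z \<noteq> 0" for t
    using assms(2) by (metis eq_iff_diff_eq_0 less_irrefl norm_cis)
  have low: "1 - norm z \<le> norm (cis t - z)" for t
    using norm_triangle_ineq2[of "cis t" z] by simp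
  have conth: "continuous_on S h" for S
    unfolding h_def using nz by (intro continuous_intros contGc) auto
  have "((\<lambda>u. G u / (u - z)) has_contour_integral (2 * of_real pi * \<i> * G z)) (circlepath 0 1)"
    using assms by (intro Cauchy_integral_circlepath_simple) auto
  then have hi: "(h has_integral (2 * of_real pi * \<i> * G z)) {0..2*pi}"
    unfolding circlepath_def h_def
    by (subst (asm) has_contour_integral_part_circlepath_iff) auto
  have cont: "continuous_on {0..2*pi} (\<lambda>t. norm (G (cis t)))"
    by (intro continuous_intros contGc)
  have "norm (2 * of_real pi * \<i> * G z) \<le>
      integral {0..2*pi} (\<lambda>t. norm (G (cis t)) / (1 - norm z))"
    unfolding integral_unique[OF hi, symmetric]
  proof (rule integral_norm_bound_integral)
    show "h integrable_on {0..2*pi}" using hi by blast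
    show "(\<lambda>t. norm (G (cis t)) / (1 - norm z)) integrable_on {0..2*pi}"
      by (intro integrable_continuous_interval continuous_intros contGc) (use assms in auto)
    show "norm (h t) \<le> norm (G (cis t)) / (1 - norm z)" for t
      using low[of t] assms(2) by (auto simp: h_def norm_mult norm_divide intro!: divide_left_mono mult_pos_pos)
  qed
  also have "\<dots> = integral {0..2*pi} (\<lambda>t. norm (G (cis t))) / (1 - norm z)"
    by simp
  also have "integral {0..2*pi} (\<lambda>t. norm (G (cis t))) =
      (\<integral>t. norm (G (cis t)) \<partial>lebesgue_on {0..2*pi})"
  proof (rule lebesgue_integral_eq_integral[symmetric])
    show "integrable (lebesgue_on {0..2*pi}) (\<lambda>t. norm (G (cis t)))"
      using cont by (rule continuous_imp_integrable_real)
  qed auto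
  finally show ?thesis
    using assms(2) pi_gt_zero by (simp add: norm_mult field_simps)
qed

section \<open>Radial limits along a sequence of radii\<close>

text \<open>Dominated convergence and measurability of limits work along sequences, so radial limits
  are sampled along one. The offset 2 makes already the first radius positive.\<close>

definition radii :: "nat \<Rightarrow> real" where
  "radii k = 1 - 1 / (real k + 2)"

lemma radii_bounds: "0 < radii k" "radii k < 1"
  by (auto simp: radii_def field_simps)

lemma radii_tendsto: "radii \<longlonglongrightarrow> 1"
  unfolding radii_def by real_asymp

lemma radii_at_left: "filterlim radii (at_left 1) sequentially"
  unfolding filterlim_at using radii_tendsto radii_bounds(2)
  by (auto intro!: always_eventually simp: less_imp_neq)

lemma has_boundary_value_radii:
  "has_boundary_value f \<zeta> l \<Longrightarrow> (\<lambda>k. f (complex_of_real (radii k) * \<zeta>)) \<longlonglongrightarrow> l"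
  unfolding has_boundary_value_def by (rule filterlim_compose[OF _ radii_at_left])

lemma has_boundary_value_unique:
  "has_boundary_value f \<zeta> l \<Longrightarrow> has_boundary_value f \<zeta> l' \<Longrightarrow> l = l'"
  unfolding has_boundary_value_def by (rule tendsto_unique[OF trivial_limit_at_left_real])

lemma radial_in_ball: "norm \<zeta> \<le> 1 \<Longrightarrow> complex_of_real (radii k) * \<zeta> \<in> ball 0 1"
  using radii_bounds[of k] mult_left_le[of "norm \<zeta>" "radii k"]
  unfolding mem_ball_0 norm_mult norm_of_real by linarith

text \<open>A function in \<open>Hinf\<close> need not extend continuously to the circle. Its
  dilates are holomorphic up to the circle, so \<open>norm_le_circle_mean\<close> applies to
  them.\<close>

lemma holomorphic_on_dilate:
  assumes "f holomorphic_on ball 0 1"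
  shows "(\<lambda>z. f (complex_of_real (radii k) * z)) holomorphic_on cball 0 1"
proof -
  have "(f \<circ> (\<lambda>z. complex_of_real (radii k) * z)) holomorphic_on cball 0 1"
    by (rule holomorphic_on_compose_gen[OF _ assms])
      (auto intro!: holomorphic_intros radial_in_ball simp del: mem_ball mem_ball_0)
  then show ?thesis by (simp add: o_def)
qed

lemma continuous_on_dilate_cis:
  assumes "f holomorphic_on ball 0 1"
  shows "continuous_on S (\<lambda>t. f (complex_of_real (radii k) * cis t))"
  by (rule continuous_on_compose2[OF holomorphic_on_imp_continuous_on[OF assms]])
    (auto intro!: continuous_intros radial_in_ball simp del: mem_ball mem_ball_0)

section \<open>Sup norm and bounds from boundary values\<close>

lemma norm_le_Hinf_norm:
  assumes "f \<in> Hinf" "z \<in> ball 0 1"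
  shows "norm (f z) \<le> Hinf_norm f"
  unfolding Hinf_norm_def
proof (rule cSUP_upper)
  show "bdd_above ((\<lambda>z. norm (f z)) ` ball 0 1)"
    using assms by (auto simp: Hinf_def bounded_iff bdd_above_def)
qed (fact assms)

text \<open>The Cauchy kernel only costs a factor \<open>1 / (1 - |z|)\<close>. It disappears on applying the
  estimate to \<open>h\<^sup>n\<close> and taking \<open>n\<close>-th roots.\<close>

lemma norm_le_boundary_bound:
  assumes h: "h \<in> Hinf"
    and bd: "AE t in lebesgue_on {0..2*pi}. \<exists>w. has_boundary_value h (cis t) w \<and> norm w \<le> m"
    and m: "0 \<le> m" and z: "z \<in> ball 0 1"
  shows "norm (h z) \<le> m"
proof -
  let ?M = "lebesgue_on {0..2*pi}"
  have holh: "h holomorphic_on ball 0 1" using h by (simp add: Hinf_def)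
  define C where "C = max m (Hinf_norm h)"
  have C: "norm (h w) \<le> C" if "w \<in> ball 0 1" for w
    using norm_le_Hinf_norm[OF h that] by (simp add: C_def)
  have z1: "norm z < 1" using z by simp
  have pow: "norm (h z) ^ n \<le> m ^ n / (1 - norm z)" for n
  proof -
    \<comment> \<open>The maximum with \<open>m ^ n\<close> makes the limit in \<open>k\<close> the
      constant \<open>m ^ n\<close> almost everywhere, so no boundary function of \<open>h\<close>
      has to be formed or shown measurable.\<close>
    define s where "s k t = max (norm (h (complex_of_real (radii k) * cis t)) ^ n) (m ^ n)" for k t
    have conts: "continuous_on {0..2*pi} (s k)" for k
      unfolding s_def by (intro continuous_intros continuous_on_dilate_cis holh)
    have meas: "s k \<in> borel_measurable ?M" for k
      by (intro continuous_imp_measurable_on_sets_lebesgue conts) auto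
    have lim: "(\<lambda>k. \<integral>t. s k t \<partial>?M) \<longlonglongrightarrow> (\<integral>t. m ^ n \<partial>?M)"
    proof (rule integral_dominated_convergence[where w = "\<lambda>_. C ^ n"])
      show "AE t in ?M. (\<lambda>k. s k t) \<longlonglongrightarrow> m ^ n"
        using bd
      proof eventually_elim
        case (elim t)
        then obtain w where w: "has_boundary_value h (cis t) w" "norm w \<le> m" by blast
        have "(\<lambda>k. s k t) \<longlonglongrightarrow> max (norm w ^ n) (m ^ n)"
          unfolding s_def by (intro tendsto_intros has_boundary_value_radii w)
        also have "max (norm w ^ n) (m ^ n) = m ^ n"
          using w by (intro max_absorb2 power_mono) auto
        finally show ?case .
      qed
      show "AE t in ?M. norm (s k t) \<le> C ^ n" for k
      proof (rule AE_I2)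
        fix t
        have "norm (h (complex_of_real (radii k) * cis t)) ^ n \<le> C ^ n"
          by (intro power_mono C radial_in_ball) auto
        moreover have "m ^ n \<le> C ^ n"
          using m by (intro power_mono) (auto simp: C_def)
        moreover have "0 \<le> m ^ n" using m by simp
        ultimately show "norm (s k t) \<le> C ^ n"
          by (auto simp: s_def)
      qed
    qed (auto intro: meas)
    have ineq: "norm (h (complex_of_real (radii k) * z)) ^ n \<le> (\<integral>t. s k t \<partial>?M) / (2 * pi * (1 - norm z))" for k
    proof -
      have "norm ((\<lambda>u. h (complex_of_real (radii k) * u) ^ n) z) \<le>
        (\<integral>t. norm ((\<lambda>u. h (complex_of_real (radii k) * u) ^ n) (cis t)) \<partial>?M) / (2 * pi * (1 - norm z))"
        by (intro norm_le_circle_mean holomorphic_intros holomorphic_on_dilate holh z1)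
      also have "\<dots> \<le> (\<integral>t. s k t \<partial>?M) / (2 * pi * (1 - norm z))"
      proof (intro divide_right_mono integral_mono)
        show "integrable ?M (\<lambda>t. norm (h (complex_of_real (radii k) * cis t) ^ n))"
          by (intro continuous_imp_integrable_real continuous_intros continuous_on_dilate_cis holh)
        show "integrable ?M (s k)"
          by (intro continuous_imp_integrable_real conts)
      qed (use z1 in \<open>auto simp: s_def norm_power\<close>)
      finally show ?thesis by (simp add: norm_power)
    qed
    have "(\<lambda>k. complex_of_real (radii k) * z) \<longlonglongrightarrow> of_real 1 * z"
      by (intro tendsto_intros radii_tendsto)
    moreover have "isCont h z"
      using holh z by (metis continuous_on_eq_continuous_at holomorphic_on_imp_continuous_on open_ball)
    ultimately have "(\<lambda>k. h (complex_of_real (radii k) * z)) \<longlonglongrightarrow> h z"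
      by (auto intro: isCont_tendsto_compose)
    then have "(\<lambda>k. norm (h (complex_of_real (radii k) * z)) ^ n) \<longlonglongrightarrow> norm (h z) ^ n"
      by (intro tendsto_intros)
    moreover have "(\<lambda>k. (\<integral>t. s k t \<partial>?M) / (2 * pi * (1 - norm z))) \<longlonglongrightarrow>
        (\<integral>t. m ^ n \<partial>?M) / (2 * pi * (1 - norm z))"
      using z1 by (intro tendsto_intros lim) auto
    ultimately have "norm (h z) ^ n \<le> (\<integral>t. m ^ n \<partial>?M) / (2 * pi * (1 - norm z))"
      using ineq by (intro tendsto_le[OF trivial_limit_sequentially]) auto
    also have "(\<integral>t. m ^ n \<partial>?M) = 2 * pi * m ^ n"
      by (simp add: measure_restrict_space)
    finally show ?thesis by simp
  qed
  show ?thesis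
  proof (rule ccontr)
    assume "\<not> ?thesis"
    then have lt: "m < norm (h z)" by simp
    \<comment> \<open>This does the work of the n-th roots: \<open>q < 1\<close>, yet by
      \<open>pow\<close> all powers of \<open>q\<close> stay above the positive number
      \<open>1 - norm z\<close>.\<close>
    define q where "q = m / norm (h z)"
    have q: "0 \<le> q" "q < 1" using lt m by (auto simp: q_def divide_less_eq)
    have "1 - norm z \<le> q ^ n" for n
    proof -
      have "0 < norm (h z) ^ n" using lt m by (intro zero_less_power) linarith
      moreover have "(1 - norm z) * norm (h z) ^ n \<le> m ^ n"
        using pow[of n] z1 by (simp add: pos_le_divide_eq mult.commute)
      ultimately show ?thesis by (simp add: q_def power_divide pos_le_divide_eq)
    qed
    moreover have "(\<lambda>n. q ^ n) \<longlonglongrightarrow> 0"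
      using q by (intro LIMSEQ_realpow_zero) auto
    ultimately have "1 - norm z \<le> 0"
      by (intro LIMSEQ_le_const) auto
    then show False using z1 by simp
  qed
qed

section \<open>Dominated series in \<open>Hinf\<close> and \<open>Kinf\<close>\<close>

text \<open>By Tannery's theorem: the summable bound \<open>c\<close> is uniform in the radius, so
  the radial limit may be taken term by term.\<close>

lemma has_boundary_value_suminf:
  assumes "\<And>k. has_boundary_value (f k) \<zeta> (l k)" "norm \<zeta> = 1"
    and "\<And>k z. z \<in> ball 0 1 \<Longrightarrow> norm (f k z) \<le> c k" "summable c"
  shows "has_boundary_value (\<lambda>z. \<Sum>k. f k z) \<zeta> (\<Sum>k. l k)" "summable l"
proof -
  have ev: "eventually (\<lambda>r. r \<in> {0<..<1}) (at_left (1::real))"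
    by (rule eventually_at_leftI[of 0]) auto
  have "eventually (\<lambda>(k, r). norm (f k (complex_of_real r * \<zeta>)) \<le> c k) (at_top \<times>\<^sub>F at_left 1)"
    using eventually_prodI[OF eventually_True ev]
    by (rule eventually_mono) (use assms(2) in \<open>auto intro!: assms(3) simp: norm_mult\<close>)
  from tannerys_theorem[OF assms(1)[unfolded has_boundary_value_def] this assms(4)]
  show "has_boundary_value (\<lambda>z. \<Sum>k. f k z) \<zeta> (\<Sum>k. l k)" "summable l"
    by (auto simp: has_boundary_value_def intro: summable_norm_cancel)
qed

lemma Hinf_suminf:
  assumes "\<And>k. f k \<in> Hinf" "\<And>k z. z \<in> ball 0 1 \<Longrightarrow> norm (f k z) \<le> c k" "summable c"
  shows "(\<lambda>z. \<Sum>k. f k z) \<in> Hinf"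
proof -
  have unif: "uniform_limit (ball 0 1) (\<lambda>n z. \<Sum>k<n. f k z) (\<lambda>z. \<Sum>k. f k z) sequentially"
    using assms(2,3) by (rule Weierstrass_m_test)
  have "(\<lambda>z. \<Sum>k. f k z) holomorphic_on ball 0 1"
  proof (rule holomorphic_uniform_sequence)
    show "(\<lambda>z. \<Sum>k<n. f k z) holomorphic_on ball 0 1" for n
      using assms(1) by (auto simp: Hinf_def intro!: holomorphic_intros)
    fix x :: complex assume "x \<in> ball 0 1"
    then obtain d where "d > 0" "cball x d \<subseteq> ball 0 1"
      using open_contains_cball open_ball by metis
    then show "\<exists>d>0. cball x d \<subseteq> ball 0 1 \<and>
        uniform_limit (cball x d) (\<lambda>n z. \<Sum>k<n. f k z) (\<lambda>z. \<Sum>k. f k z) sequentially"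
      using uniform_limit_on_subset[OF unif] by blast
  qed auto
  moreover have "norm (\<Sum>k. f k z) \<le> (\<Sum>k. c k)" if "z \<in> ball 0 1" for z
    using assms(2)[OF that] assms(3) by (intro norm_suminf_le)
  ultimately show ?thesis
    unfolding Hinf_def bounded_iff by blast
qed

lemma Kinf_subset_Hinf: "Kinf \<theta> \<subseteq> Hinf"
  by (auto simp: Kinf_def)

text \<open>The witness for the sum is the sum of the witnesses \<open>h k\<close>, which needs
  bounds on them. Since \<open>\<theta>\<close> is unimodular on the circle, the boundary values of
  \<open>h k\<close> have the moduli of those of \<open>f k\<close>, hence are at most
  \<open>c k\<close>, and \<open>norm_le_boundary_bound\<close> carries this into the disk.\<close>

lemma Kinf_suminf:
  assumes uni: "AE t in lebesgue_on {0..2*pi}. \<forall>v. has_boundary_value \<theta> (cis t) v \<longrightarrow> norm v = 1"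
    and f: "\<And>k. f k \<in> Kinf \<theta>" and le: "\<And>k z. z \<in> ball 0 1 \<Longrightarrow> norm (f k z) \<le> c k"
    and c: "summable c"
  shows "(\<lambda>z. \<Sum>k. f k z) \<in> Kinf \<theta>"
proof -
  let ?M = "lebesgue_on {0..2*pi}"
  have "\<exists>h. \<forall>k. h k \<in> Hinf \<and> (AE t in ?M. \<exists>u v w. has_boundary_value (f k) (cis t) u \<and>
      has_boundary_value \<theta> (cis t) v \<and> has_boundary_value (h k) (cis t) w \<and> u = v * cnj (cis t * w))"
    using f by (intro choice) (auto simp: Kinf_def)
  then obtain h where h: "\<And>k. h k \<in> Hinf" and
    bd: "\<And>k. AE t in ?M. \<exists>u v w. has_boundary_value (f k) (cis t) u \<and>
      has_boundary_value \<theta> (cis t) v \<and> has_boundary_value (h k) (cis t) w \<and> u = v * cnj (cis t * w)"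
    by blast
  have cpos: "0 \<le> c k" for k
    using le[of 0 k] norm_ge_zero[of "f k 0"] by (meson centre_in_ball order_trans zero_less_one)
  have hle: "norm (h k z) \<le> c k" if "z \<in> ball 0 1" for k z
  proof (rule norm_le_boundary_bound[OF h _ cpos that])
    show "AE t in ?M. \<exists>w. has_boundary_value (h k) (cis t) w \<and> norm w \<le> c k"
      using bd[of k] uni
    proof eventually_elim
      case (elim t)
      then obtain u v w where *: "has_boundary_value (f k) (cis t) u" "has_boundary_value \<theta> (cis t) v"
        "has_boundary_value (h k) (cis t) w" "u = v * cnj (cis t * w)" by blast
      have "norm u \<le> c k"
      proof (rule LIMSEQ_le_const2)
        show "(\<lambda>i. norm (f k (complex_of_real (radii i) * cis t))) \<longlonglongrightarrow> norm u"
          by (intro tendsto_intros has_boundary_value_radii *)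
      qed (auto intro!: le radial_in_ball simp del: mem_ball)
      moreover have "norm v = 1" using elim * by blast
      ultimately show ?case using * by (auto simp: norm_mult)
    qed
  qed
  have "AE t in ?M. \<forall>k. \<exists>u v w. has_boundary_value (f k) (cis t) u \<and>
      has_boundary_value \<theta> (cis t) v \<and> has_boundary_value (h k) (cis t) w \<and> u = v * cnj (cis t * w)"
    using bd by (simp add: AE_all_countable)
  then have "AE t in ?M. \<exists>u v w. has_boundary_value (\<lambda>z. \<Sum>k. f k z) (cis t) u \<and>
      has_boundary_value \<theta> (cis t) v \<and> has_boundary_value (\<lambda>z. \<Sum>k. h k z) (cis t) w \<and>
      u = v * cnj (cis t * w)"
  proof eventually_elim
    case (elim t)
    \<comment> \<open>Radial limits are unique, so one value \<open>v\<close> of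
      \<open>\<theta>\<close> serves all \<open>k\<close>. What remains is that
      \<open>v * cnj (cis t * w)\<close> is additive and continuous in \<open>w\<close>, hence
      respects series.\<close>
    then obtain v where v: "has_boundary_value \<theta> (cis t) v" by blast
    have "\<forall>k. \<exists>w. has_boundary_value (h k) (cis t) w \<and>
        has_boundary_value (f k) (cis t) (v * cnj (cis t * w))"
      using elim has_boundary_value_unique[OF v] by metis
    then obtain w where w: "\<And>k. has_boundary_value (h k) (cis t) (w k)"
      "\<And>k. has_boundary_value (f k) (cis t) (v * cnj (cis t * w k))" by metis
    note hs = has_boundary_value_suminf[OF w(1) norm_cis hle c]
    have "(\<lambda>k. v * cnj (cis t * w k)) sums (v * cnj (cis t * (\<Sum>k. w k)))"
      by (intro sums_mult sums_cnj[THEN iffD2] summable_sums hs)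
    then have "(\<Sum>k. v * cnj (cis t * w k)) = v * cnj (cis t * (\<Sum>k. w k))"
      by (rule sums_unique[symmetric])
    then show ?case
      using has_boundary_value_suminf(1)[OF w(2) norm_cis le c] hs(1) v by metis
  qed
  moreover have "(\<lambda>z. \<Sum>k. f k z) \<in> Hinf"
    using f Kinf_subset_Hinf by (intro Hinf_suminf[OF _ le c]) auto
  moreover have "(\<lambda>z. \<Sum>k. h k z) \<in> Hinf"
    by (intro Hinf_suminf[OF h hle c])
  ultimately show ?thesis unfolding Kinf_def by blast
qed

section \<open>The Schwarz lemma at an arbitrary base point\<close>

text \<open>Move \<open>a\<close> to the origin by a disk automorphism and apply the Schwarz lemma
  to the increment of \<open>f\<close> from \<open>a\<close>. The factor 2 is the triangle
  inequality for that increment.\<close>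

lemma norm_diff_le_pseudohyp_dist:
  assumes f: "f \<in> Hinf" and a: "a \<in> ball 0 1" and z: "z \<in> ball 0 1"
  shows "norm (f z - f a) \<le> 2 * Hinf_norm f * pseudohyp_dist a z"
proof (rule field_le_epsilon)
  fix e :: real assume e: "0 < e"
  have nneg: "0 \<le> Hinf_norm f" using norm_le_Hinf_norm[OF f a] norm_ge_zero order_trans by blast
  \<comment> \<open>The surplus \<open>e\<close> gives the strict bound that the Schwarz lemma asks
    for, and keeps the divisor positive when \<open>f\<close> vanishes on the disk.\<close>
  define C where "C = 2 * Hinf_norm f + e"
  have C: "C > 0" using nneg e by (simp add: C_def)
  have na: "norm a < 1" "norm (-a) < 1" using a by auto
  define \<phi> where "\<phi> = Moebius_function 0 (-a)"
  define w where "w = Moebius_function 0 a z"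
  define g where "g u = (f (\<phi> u) - f a) / of_real C" for u
  have \<phi>: "\<phi> u \<in> ball 0 1" if "norm u < 1" for u
    using Moebius_function_norm_lt_1[OF na(2) that] by (simp add: \<phi>_def)
  have w: "norm w < 1" using Moebius_function_norm_lt_1[OF na(1)] z by (simp add: w_def)
  have "(f \<circ> \<phi>) holomorphic_on ball 0 1"
    by (rule holomorphic_on_compose_gen[where t = "ball 0 1"])
      (use f \<phi> Moebius_function_holomorphic[OF na(2)] in \<open>auto simp: \<phi>_def Hinf_def\<close>)
  then have hol: "g holomorphic_on ball 0 1"
    unfolding g_def o_def using C by (intro holomorphic_intros) auto
  have g0: "g 0 = 0" by (simp add: g_def \<phi>_def Moebius_function_of_zero)
  have "norm (g w) \<le> norm w"
  proof (rule Schwarz_Lemma(1)[OF hol g0 _ w])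
    fix u :: complex assume "norm u < 1"
    then have "norm (f (\<phi> u) - f a) \<le> 2 * Hinf_norm f"
      using norm_triangle_ineq4[of "f (\<phi> u)" "f a"] norm_le_Hinf_norm[OF f \<phi>] norm_le_Hinf_norm[OF f a]
      by fastforce
    then have "norm (f (\<phi> u) - f a) < C" using e by (simp add: C_def)
    then show "norm (g u) < 1" using C by (simp add: g_def norm_divide)
  qed
  moreover have "\<phi> w = z"
    unfolding \<phi>_def w_def by (rule Moebius_function_compose) (use a z in auto)
  moreover have "norm w = pseudohyp_dist a z"
    by (simp add: w_def pseudohyp_dist_def Moebius_function_simple)
  ultimately have "norm (f z - f a) \<le> 2 * Hinf_norm f * pseudohyp_dist a z + e * norm w"
    using C by (simp add: g_def norm_divide pos_divide_le_eq) (simp add: C_def algebra_simps)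
  also have "e * norm w \<le> e" using e w by (simp add: mult_left_le)
  finally show "norm (f z - f a) \<le> 2 * Hinf_norm f * pseudohyp_dist a z + e" by simp
qed

section \<open>Blaschke factors\<close>

lemma norm_blaschke_factor: "norm (blaschke_factor a z) = pseudohyp_dist a z"
  by (simp add: blaschke_factor_def pseudohyp_dist_def norm_mult norm_divide)

lemma pseudohyp_dist_less_1: "a \<in> ball 0 1 \<Longrightarrow> z \<in> ball 0 1 \<Longrightarrow> pseudohyp_dist a z < 1"
  using Moebius_function_norm_lt_1[of a z 0] by (simp add: pseudohyp_dist_def Moebius_function_simple)

lemma one_minus_cnj_mult_nonzero:
  fixes a z :: complex
  assumes "norm a < 1" "norm z \<le> 1"
  shows "1 - cnj a * z \<noteq> 0"
proof
  assume "1 - cnj a * z = 0"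
  then have "norm a * norm z = 1" by (metis complex_mod_cnj eq_iff_diff_eq_0 norm_mult norm_one)
  moreover have "norm a * norm z \<le> norm a" using assms by (intro mult_left_le) auto
  ultimately show False using assms by linarith
qed

text \<open>On the circle \<open>1 = z * cnj z\<close>, so the denominator becomes
  \<open>z * cnj (z - a)\<close>, which has the modulus of the numerator.\<close>

lemma pseudohyp_dist_unit_circle:
  assumes "norm a < 1" "norm z = 1"
  shows "pseudohyp_dist a z = 1"
proof -
  have "z * cnj z = 1" using assms(2) by (simp add: complex_norm_square[symmetric])
  then have "1 - cnj a * z = z * cnj (z - a)" by (simp add: algebra_simps)
  then have "norm (1 - cnj a * z) = norm (z - a)"
    using assms(2) by (metis complex_mod_cnj mult_1 norm_mult)
  moreover have "z \<noteq> a" using assms by auto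
  ultimately show ?thesis by (simp add: pseudohyp_dist_def norm_divide)
qed

lemma holomorphic_on_blaschke_factor:
  "norm a < 1 \<Longrightarrow> blaschke_factor a holomorphic_on cball 0 1"
  unfolding blaschke_factor_def
  using one_minus_cnj_mult_nonzero[of a] by (intro holomorphic_intros) auto

text \<open>This makes the Blaschke condition yield absolute convergence of the product at each
  point. For \<open>a \<noteq> 0\<close>, the identity \<open>a * cnj a = (norm a)^2\<close> lets
  \<open>1 - norm a\<close> be factored out of the difference; \<open>a = 0\<close> falls under the
  separate convention.\<close>

lemma norm_blaschke_factor_diff_1:
  assumes a: "norm a < 1" and z: "norm z < 1"
  shows "norm (blaschke_factor a z - 1) \<le> (1 - norm a) * (2 / (1 - norm z))"
proof (cases "a = 0")
  case True
  have "norm (-z - 1) \<le> 2" using norm_triangle_ineq4[of "-z" 1] z by simp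
  also have "2 \<le> 2 / (1 - norm z)" using z by (simp add: field_simps)
  finally show ?thesis using True by (simp add: blaschke_factor_def)
next
  case False
  have nz: "1 - cnj a * z \<noteq> 0" using a z by (intro one_minus_cnj_mult_nonzero) auto
  have "a * cnj a = of_real (norm a) * of_real (norm a)"
    by (simp add: complex_norm_square[symmetric] power2_eq_square)
  then have "blaschke_factor a z - 1 =
      - (of_real (1 - norm a) * (a + of_real (norm a) * z) / (a * (1 - cnj a * z)))"
    using False nz by (simp add: blaschke_factor_def divide_simps) (simp add: algebra_simps)
  then have "norm (blaschke_factor a z - 1) =
      (1 - norm a) * (norm (a + of_real (norm a) * z) / (norm a * norm (1 - cnj a * z)))"
    using a by (simp only: norm_minus_cancel norm_divide norm_mult norm_of_real) simp
  also have "\<dots> \<le> (1 - norm a) * ((norm a * 2) / (norm a * (1 - norm z)))"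
  proof (intro mult_left_mono frac_le mult_left_mono)
    have "norm (a + of_real (norm a) * z) \<le> norm a + norm a * norm z"
      using norm_triangle_ineq[of a "of_real (norm a) * z"] by (simp add: norm_mult)
    also have "\<dots> \<le> norm a * 2" using z mult_left_le[of "norm z" "norm a"] by simp
    finally show "norm (a + of_real (norm a) * z) \<le> norm a * 2" .
    have "norm (cnj a * z) \<le> norm z" using a by (simp add: norm_mult mult_left_le_one_le)
    then show "1 - norm z \<le> norm (1 - cnj a * z)"
      using norm_triangle_ineq2[of 1 "cnj a * z"] by simp
  qed (use a z False in auto)
  also have "\<dots> = (1 - norm a) * (2 / (1 - norm z))" using False by simp
  finally show ?thesis .
qed

section \<open>Unimodular boundary values of Blaschke products\<close>

lemma summable_tail_tendsto_0:
  fixes x :: "nat \<Rightarrow> real"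
  assumes "summable x"
  shows "(\<lambda>N. \<Sum>j. x (j + N)) \<longlonglongrightarrow> 0"
proof -
  have "(\<lambda>N. suminf x - (\<Sum>j<N. x j)) \<longlonglongrightarrow> suminf x - suminf x"
    by (intro tendsto_intros summable_LIMSEQ assms)
  then show ?thesis by (simp add: suminf_minus_initial_segment[OF assms])
qed

text \<open>The tail \<open>P\<^sub>N\<close> of the product has the same boundary moduli as \<open>B\<close>, so the mean of \<open>|B|\<close> over the
  circle is at least \<open>|P\<^sub>N(0)|\<close>, which tends to 1.\<close>

lemma blaschke_product_unimodular:
  assumes B: "blaschke_product a B"
    and bd: "AE t in lebesgue_on {0..2*pi}. \<exists>v. has_boundary_value B (cis t) v"
  shows "AE t in lebesgue_on {0..2*pi}. \<forall>v. has_boundary_value B (cis t) v \<longrightarrow> norm v = 1"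
proof -
  let ?M = "lebesgue_on {0..2*pi}"
  have a: "norm (a j) < 1" for j using B by (simp add: blaschke_product_def)
  have a0: "a j \<in> ball 0 1" for j using a by simp
  have sum: "summable (\<lambda>j. 1 - norm (a j))" using B by (simp add: blaschke_product_def)
  obtain l where l: "norm l = 1" "\<And>z. z \<in> ball 0 1 \<Longrightarrow> B z = l * (\<Prod>j. blaschke_factor (a j) z)"
    using B by (auto simp: blaschke_product_def)
  have conv: "convergent_prod (\<lambda>j. blaschke_factor (a j) z)" if "z \<in> ball 0 1" for z
  proof (intro abs_convergent_prod_imp_convergent_prod summable_imp_abs_convergent_prod)
    show "summable (\<lambda>j. norm (blaschke_factor (a j) z - 1))"
      by (rule summable_comparison_test'[OF summable_mult2[OF sum, of "2 / (1 - norm z)"]])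
        (use norm_blaschke_factor_diff_1[OF a] that in auto)
  qed
  \<comment> \<open>\<open>F\<close> plays two roles: \<open>F 0 N\<close> is the finite head split
    off \<open>B\<close>, and \<open>F N m\<close> approximates the tail \<open>P N\<close> as
    \<open>m\<close> grows. Holomorphy is used for finite products only; \<open>P N\<close> enters
    as their pointwise limit.\<close>
  define F where "F N m z = (\<Prod>j<m. blaschke_factor (a (j + N)) z)" for N m z
  define P where "P N z = (\<Prod>j. blaschke_factor (a (j + N)) z)" for N z
  have F_lim: "(\<lambda>m. F N m z) \<longlonglongrightarrow> P N z" if "z \<in> ball 0 1" for N z
    using convergent_prod_LIMSEQ[OF convergent_prod_ignore_initial_segment[OF conv[OF that], of N]]
    by (simp add: F_def P_def LIMSEQ_lessThan_iff_atMost)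
  have F_le: "norm (F N m z) \<le> 1" if "z \<in> ball 0 1" for N m z
    unfolding F_def prod_norm[symmetric] norm_blaschke_factor
    using pseudohyp_dist_less_1[OF a0 that] by (intro prod_le_1) (auto simp: pseudohyp_dist_def less_imp_le)
  have P_le: "norm (P N z) \<le> 1" if "z \<in> ball 0 1" for N z
    by (rule LIMSEQ_le_const2[OF tendsto_norm[OF F_lim[OF that]]]) (auto intro: F_le[OF that])
  have split: "norm (B z) = norm (F 0 N z) * norm (P N z)" if "z \<in> ball 0 1" for N z
    using has_prod_unique[OF has_prod_ignore_initial_segment'[OF conv[OF that], of N], symmetric] l that
    by (simp add: F_def P_def norm_mult)
  have holF: "F N m holomorphic_on cball 0 1" for N m
    unfolding F_def by (intro holomorphic_intros holomorphic_on_blaschke_factor a)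
  then have holF': "F N m holomorphic_on ball 0 1" for N m
    by (rule holomorphic_on_subset) auto
  have measF: "(\<lambda>t. norm (F N m (complex_of_real (radii k) * cis t))) \<in> borel_measurable ?M" for N m k
    by (intro continuous_imp_measurable_on_sets_lebesgue continuous_intros continuous_on_dilate_cis holF') auto
  have in_ball: "complex_of_real (radii k) * cis t \<in> ball 0 1" for k t
    by (rule radial_in_ball) simp
  have measP: "(\<lambda>t. norm (P N (complex_of_real (radii k) * cis t))) \<in> borel_measurable ?M" for N k
    by (rule borel_measurable_LIMSEQ_metric[where f = "\<lambda>m t. norm (F N m (complex_of_real (radii k) * cis t))"])
      (intro measF tendsto_norm F_lim in_ball)+
  \<comment> \<open>Shown first for the finite products: at 0 their modulus is a product of
    \<open>norm (a j)\<close>, at least 1 minus the sum of the defects, and the mean value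
    inequality applies. Dominated convergence then gives the tail. The lower bound is the same for
    every radius.\<close>
  have mean: "2 * pi * (1 - (\<Sum>j. 1 - norm (a (j + N)))) \<le>
      (\<integral>t. norm (P N (complex_of_real (radii k) * cis t)) \<partial>?M)" for N k
  proof (rule tendsto_le[OF trivial_limit_sequentially])
    show "(\<lambda>m. 2 * pi * (1 - (\<Sum>j<m. 1 - norm (a (j + N))))) \<longlonglongrightarrow>
        2 * pi * (1 - (\<Sum>j. 1 - norm (a (j + N))))"
      by (intro tendsto_intros summable_LIMSEQ summable_ignore_initial_segment sum)
    show "(\<lambda>m. \<integral>t. norm (F N m (complex_of_real (radii k) * cis t)) \<partial>?M) \<longlonglongrightarrow>
        (\<integral>t. norm (P N (complex_of_real (radii k) * cis t)) \<partial>?M)"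
      by (rule integral_dominated_convergence[where w = "\<lambda>_. 1"])
        (auto intro!: measF measP AE_I2 tendsto_norm F_lim in_ball F_le simp del: mem_ball mem_ball_0)
    have "2 * pi * (1 - (\<Sum>j<m. 1 - norm (a (j + N)))) \<le>
        (\<integral>t. norm (F N m (complex_of_real (radii k) * cis t)) \<partial>?M)" for m
    proof -
      have "1 - (\<Sum>j<m. 1 - norm (a (j + N))) \<le> (\<Prod>j<m. 1 - (1 - norm (a (j + N))))"
        using a by (intro Weierstrass_prod_ineq) (auto intro: less_imp_le)
      also have "\<dots> = norm (F N m 0)"
        by (simp add: F_def prod_norm[symmetric] norm_blaschke_factor pseudohyp_dist_def)
      also have "\<dots> \<le> (\<integral>t. norm (F N m (complex_of_real (radii k) * cis t)) \<partial>?M) / (2 * pi)"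
        using norm_le_circle_mean[OF holomorphic_on_dilate[OF holF'], of 0] by simp
      finally show ?thesis using pi_gt_zero by (simp add: field_simps)
    qed
    then show "\<forall>\<^sub>F m in sequentially. 2 * pi * (1 - (\<Sum>j<m. 1 - norm (a (j + N)))) \<le>
        (\<integral>t. norm (F N m (complex_of_real (radii k) * cis t)) \<partial>?M)" by simp
  qed
  \<comment> \<open>A measurable stand-in for the modulus of the boundary function of
    \<open>B\<close>. Its values where \<open>B\<close> has no radial limit do not matter, because
    by \<open>bd\<close> they lie over a null set.\<close>
  define v' where "v' t = lim (\<lambda>k. norm (B (complex_of_real (radii k) * cis t)))" for t
  have v': "v' t = norm v" if "has_boundary_value B (cis t) v" for t v
    unfolding v'_def by (intro limI tendsto_norm has_boundary_value_radii that)
  have measB: "(\<lambda>t. norm (B (complex_of_real (radii k) * cis t))) \<in> borel_measurable ?M" for k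
    using measP[of 0 k] split[OF in_ball, of _ _ 0] by (simp add: F_def)
  have measv: "v' \<in> borel_measurable ?M"
    unfolding v'_def by (intro borel_measurable_lim_metric measB)
  have v'_le: "norm v \<le> 1" if "has_boundary_value B (cis t) v" for t v
    by (rule LIMSEQ_le_const2[OF tendsto_norm[OF has_boundary_value_radii[OF that]]])
      (use P_le[OF in_ball] split[OF in_ball, of _ _ 0] in \<open>auto simp: F_def\<close>)
  have limP: "(\<lambda>k. \<integral>t. norm (P N (complex_of_real (radii k) * cis t)) \<partial>?M) \<longlonglongrightarrow> (\<integral>t. v' t \<partial>?M)" for N
  proof (rule integral_dominated_convergence[where w = "\<lambda>_. 1"])
    show "AE t in ?M. (\<lambda>k. norm (P N (complex_of_real (radii k) * cis t))) \<longlonglongrightarrow> v' t"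
      using bd
    proof eventually_elim
      case (elim t)
      then obtain v where v: "has_boundary_value B (cis t) v" by blast
      have "(\<lambda>k. complex_of_real (radii k) * cis t) \<longlonglongrightarrow> of_real 1 * cis t"
        by (intro tendsto_intros radii_tendsto)
      then have "(\<lambda>k. F 0 N (complex_of_real (radii k) * cis t)) \<longlonglongrightarrow> F 0 N (cis t)"
        by (intro continuous_on_tendsto_compose[OF holomorphic_on_imp_continuous_on[OF holF]])
          (use in_ball in \<open>auto intro!: always_eventually intro: less_imp_le\<close>)
      then have F1: "(\<lambda>k. norm (F 0 N (complex_of_real (radii k) * cis t))) \<longlonglongrightarrow> norm (F 0 N (cis t))"
        by (rule tendsto_norm)
      have F_cis: "norm (F 0 N (cis t)) = 1"
        by (simp add: F_def prod_norm[symmetric] norm_blaschke_factor pseudohyp_dist_unit_circle a)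
      have "(\<lambda>k. norm (B (complex_of_real (radii k) * cis t)) / norm (F 0 N (complex_of_real (radii k) * cis t)))
          \<longlonglongrightarrow> norm v / norm (F 0 N (cis t))"
        by (intro tendsto_divide[OF tendsto_norm F1] has_boundary_value_radii v) (simp add: F_cis)
      \<comment> \<open>The head may vanish inside the disk, where dividing by it would not recover
        \<open>P N\<close>. Its modulus tends to 1, so this affects only finitely many
        \<open>k\<close>.\<close>
      moreover have "\<forall>\<^sub>F k in sequentially. norm (F 0 N (complex_of_real (radii k) * cis t)) > 0"
        by (rule order_tendstoD(1)[OF F1]) (simp add: F_cis)
      then have "\<forall>\<^sub>F k in sequentially. norm (B (complex_of_real (radii k) * cis t)) /
          norm (F 0 N (complex_of_real (radii k) * cis t)) = norm (P N (complex_of_real (radii k) * cis t))"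
        by eventually_elim (simp add: split[OF in_ball, of _ _ N])
      ultimately have "(\<lambda>k. norm (P N (complex_of_real (radii k) * cis t))) \<longlonglongrightarrow> norm v / norm (F 0 N (cis t))"
        by (rule Lim_transform_eventually)
      then show ?case using v'[OF v] F_cis by simp
    qed
  qed (auto intro!: measv measP AE_I2 P_le in_ball simp del: mem_ball mem_ball_0)
  have "2 * pi * (1 - (\<Sum>j. 1 - norm (a (j + N)))) \<le> (\<integral>t. v' t \<partial>?M)" for N
    by (rule LIMSEQ_le_const[OF limP]) (use mean in blast)
  moreover have "(\<lambda>N. 2 * pi * (1 - (\<Sum>j. 1 - norm (a (j + N))))) \<longlonglongrightarrow> 2 * pi * (1 - 0)"
    by (intro tendsto_intros summable_tail_tendsto_0 sum)
  ultimately have ge: "2 * pi \<le> (\<integral>t. v' t \<partial>?M)"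
    by (auto dest: LIMSEQ_le_const2)
  \<comment> \<open>With \<open>v' \<le> 1\<close> almost everywhere on an interval of length
    \<open>2 * pi\<close>, the bound \<open>ge\<close> leaves only \<open>v' = 1\<close> almost
    everywhere.\<close>
  have v_bounds: "AE t in ?M. 0 \<le> v' t \<and> v' t \<le> 1"
    using bd by eventually_elim (use v' v'_le in fastforce)
  have intv: "integrable ?M v'"
    by (rule Bochner_Integration.integrable_bound[where f = "\<lambda>_. 1::real"]) (use measv v_bounds in auto)
  have "(\<integral>t. 1 - v' t \<partial>?M) = 2 * pi - (\<integral>t. v' t \<partial>?M)"
    using intv by (simp add: measure_restrict_space)
  moreover have "0 \<le> (\<integral>t. 1 - v' t \<partial>?M)"
    by (rule integral_nonneg_AE) (use v_bounds in auto)
  ultimately have "(\<integral>t. 1 - v' t \<partial>?M) = 0" using ge by linarith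
  then have "AE t in ?M. 1 - v' t = 0"
    by (subst (asm) integral_nonneg_eq_0_iff_AE) (use intv v_bounds in auto)
  then show ?thesis
    by eventually_elim (use v' in auto)
qed

section \<open>Iterated correction of the interpolation error\<close>

theorem theorem4p2:
  fixes B :: "complex \<Rightarrow> complex" and a z :: "nat \<Rightarrow> complex" and M \<epsilon> :: real
  assumes "blaschke_product a B"
    and "interpolating_for (Kinf B) a"
    and "\<And>f. f \<in> Kinf B \<Longrightarrow> Hinf_norm f \<le> M * (SUP n. norm (f (a n)))"
    and "\<And>n. z n \<in> ball 0 1"
    and "inj z"
    and "\<And>n. pseudohyp_dist (a n) (z n) < 1 - \<epsilon>"
    and "1 - \<epsilon> < 1 / (2 * M)"
  shows "interpolating_for (Kinf B) z"
proof -
  have a: "a n \<in> ball 0 1" for n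
    using assms(2) by (simp add: interpolating_for_def)
  have interp: "\<exists>f\<in>Kinf B. \<forall>n. f (a n) = \<alpha> n" if "bounded (range \<alpha>)" for \<alpha>
    using assms(2) that by (simp add: interpolating_for_def)
  \<comment> \<open>The constant data 1 serve twice: membership of \<open>f1\<close> in
    \<open>Kinf B\<close> includes the existence of boundary values of \<open>B\<close> almost
    everywhere, so Fatou's theorem is not invoked, and the norm of \<open>f1\<close> is at least 1,
    which forces \<open>M \<ge> 1\<close>.\<close>
  obtain f1 where f1: "f1 \<in> Kinf B" "\<And>n. f1 (a n) = 1"
    using interp[of "\<lambda>_. 1"] by auto
  have "AE t in lebesgue_on {0..2*pi}. \<exists>v. has_boundary_value B (cis t) v"
    using f1(1) unfolding Kinf_def by (auto elim!: eventually_mono)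
  note uni = blaschke_product_unimodular[OF assms(1) this]
  have "1 \<le> Hinf_norm f1"
    using norm_le_Hinf_norm[of f1 "a 0"] f1 Kinf_subset_Hinf a by fastforce
  then have M: "1 \<le> M" using assms(3)[OF f1(1)] f1(2) by simp
  define q where "q = 2 * M * (1 - \<epsilon>)"
  have eps: "0 < 1 - \<epsilon>"
    using assms(6)[of 0] by (rule le_less_trans[rotated]) (simp add: pseudohyp_dist_def)
  have q: "0 < q" "q < 1"
    using M assms(7) eps by (simp_all add: q_def field_simps)
  show ?thesis
    unfolding interpolating_for_def
  proof (intro conjI allI impI)
    show "z n \<in> ball 0 1" for n by (fact assms(4))
  next
    fix \<alpha> :: "nat \<Rightarrow> complex" assume "bounded (range \<alpha>)"
    then obtain A where A: "\<And>n. norm (\<alpha> n) \<le> A" by (auto simp: bounded_iff)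
    have A0: "0 \<le> A" using A[of 0] norm_ge_zero order_trans by blast
    \<comment> \<open>An arbitrary choice of interpolant: no linearity in the data is needed, only
      the prescribed values and the norm bound. It is meaningful for bounded data only, hence
      \<open>\<beta>_bounded\<close> below.\<close>
    define T where "T \<beta> = (SOME f. f \<in> Kinf B \<and> (\<forall>n. f (a n) = \<beta> n))" for \<beta>
    have T: "T \<beta> \<in> Kinf B" "T \<beta> (a n) = \<beta> n" if "bounded (range \<beta>)" for \<beta> n
      using someI_ex[of "\<lambda>f. f \<in> Kinf B \<and> (\<forall>n. f (a n) = \<beta> n)"] interp[OF that]
      unfolding T_def by auto
    have T_le: "Hinf_norm (T \<beta>) \<le> M * C" and T_err: "norm (\<beta> n - T \<beta> (z n)) \<le> q * C"
      if \<beta>: "\<And>n. norm (\<beta> n) \<le> C" for \<beta> C n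
    proof -
      have b: "bounded (range \<beta>)" using \<beta> by (auto simp: bounded_iff)
      have "(SUP n. norm (T \<beta> (a n))) \<le> C" by (rule cSUP_least) (auto simp: T(2)[OF b] \<beta>)
      then show *: "Hinf_norm (T \<beta>) \<le> M * C"
        using assms(3)[OF T(1)[OF b]] M by (meson mult_left_mono order_trans zero_le_one)
      have C0: "0 \<le> C" using \<beta>[of 0] norm_ge_zero order_trans by blast
      \<comment> \<open>The datum is itself a value of \<open>T \<beta>\<close>, at
        \<open>a n\<close>, so the error is the increment of a single function between
        \<open>a n\<close> and \<open>z n\<close>.\<close>
      have "norm (\<beta> n - T \<beta> (z n)) = norm (T \<beta> (z n) - T \<beta> (a n))"
        by (simp add: T(2)[OF b] norm_minus_commute)
      also have "\<dots> \<le> 2 * Hinf_norm (T \<beta>) * pseudohyp_dist (a n) (z n)"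
        using T(1)[OF b] Kinf_subset_Hinf a assms(4) by (intro norm_diff_le_pseudohyp_dist) auto
      also have "\<dots> \<le> 2 * (M * C) * (1 - \<epsilon>)"
        using * assms(6)[of n] C0 M by (intro mult_mono[OF mult_left_mono]) (auto simp: pseudohyp_dist_def)
      finally show "norm (\<beta> n - T \<beta> (z n)) \<le> q * C" by (simp add: q_def mult_ac)
    qed
    \<comment> \<open>\<open>\<beta> k\<close> is the error left at the points \<open>z n\<close>
      after \<open>k\<close> corrections. The next correction takes this error as its values at the
      points \<open>a n\<close>, where interpolation is possible.\<close>
    define \<beta> where "\<beta> = rec_nat \<alpha> (\<lambda>_ \<gamma> n. \<gamma> n - T \<gamma> (z n))"
    have \<beta>_0: "\<beta> 0 = \<alpha>" and \<beta>_Suc: "\<beta> (Suc k) n = \<beta> k n - T (\<beta> k) (z n)" for k n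
      by (simp_all add: \<beta>_def)
    have \<beta>_le: "norm (\<beta> k n) \<le> A * q ^ k" for k n
    proof (induction k arbitrary: n)
      case 0
      then show ?case by (simp add: \<beta>_0 A)
    next
      case (Suc k)
      show ?case using T_err[of "\<beta> k" "A * q ^ k" n] Suc.IH by (simp add: \<beta>_Suc mult_ac)
    qed
    have \<beta>_bounded: "bounded (range (\<beta> k))" for k using \<beta>_le by (auto simp: bounded_iff)
    have TK: "T (\<beta> k) \<in> Kinf B" for k by (rule T(1)[OF \<beta>_bounded])
    have le: "norm (T (\<beta> k) w) \<le> M * (A * q ^ k)" if "w \<in> ball 0 1" for k w
      using norm_le_Hinf_norm[OF _ that] TK Kinf_subset_Hinf T_le[of "\<beta> k" "A * q ^ k"] \<beta>_le by (meson order_trans subsetD)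
    have sum: "summable (\<lambda>k. M * (A * q ^ k))"
      using q by (intro summable_mult summable_geometric) auto
    have "(\<lambda>w. \<Sum>k. T (\<beta> k) w) \<in> Kinf B"
      by (rule Kinf_suminf[OF uni TK le sum])
    moreover have "(\<Sum>k. T (\<beta> k) (z n)) = \<alpha> n" for n
    proof (rule sums_unique[symmetric])
      \<comment> \<open>At \<open>z n\<close> each correction is the drop from one error to the
        next, so the series telescopes to the initial error \<open>\<alpha> n\<close> minus the
        limit 0.\<close>
      have "(\<lambda>k. A * q ^ k) \<longlonglongrightarrow> 0"
        using q by (intro tendsto_mult_right_zero LIMSEQ_realpow_zero) auto
      then have "(\<lambda>k. \<beta> k n) \<longlonglongrightarrow> 0"
        by (rule Lim_null_comparison[OF always_eventually, rotated]) (intro allI \<beta>_le)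
      then have "(\<lambda>k. \<beta> k n - \<beta> (Suc k) n) sums (\<beta> 0 n - 0)"
        by (rule telescope_sums')
      then show "(\<lambda>k. T (\<beta> k) (z n)) sums \<alpha> n" by (simp add: \<beta>_Suc \<beta>_0)
    qed
    ultimately show "\<exists>f\<in>Kinf B. \<forall>n. f (z n) = \<alpha> n"
      by (intro bexI[of _ "\<lambda>w. \<Sum>k. T (\<beta> k) w"]) auto
  qed
qed

end
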